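(* Let $A>0$ be fixed. For $N\ge2$ and $M=1$, $$\frac{1}{\gamma_{opt}(N,1)}=\frac1{N+1}\;>\;\frac{\alpha_{opt}(N,1)}{2}=\frac1{2N}.$$ Conversely, for $N=M$, one has $\alpha_{opt}(N,N)=1$, and this best value is attained: there is a smooth field $a:\mathbb{R}^N\to\mathbb{R}^N$ satisfying the measure non-degeneracy condition $(\alpha)$ with $\alpha=1$ (so that the exponent $\alpha/2$ equals $1/2$).
   Context: Let $N,M\ge1$ be integers and let $S^N$ be the unit sphere of $\mathbb{R}^{N+1}=\mathbb{R}\times\mathbb{R}^N$. Measure non-degeneracy condition $(\alpha)$: a field $a:[-A,A]^M\to\mathbb{R}^N$ (or the restriction to $[-A,A]^M$ of a field on $\mathbb{R}^M$) satisfies the condition with exponent $\alpha\in(0,1]$ if there is $C>0$ such that for all $(u,\sigma)\in S^N$ ($u\in\mathbb{R}$, $\sigma\in\mathbb{R}^N$) and all $\varepsilon>0$, $\operatorname{meas}(\{v\in[-A,A]^M: u-\varepsilon<a(v)\cdot\sigma<u+\varepsilon\})\le C\varepsilon^\alpha$. $\alpha_{opt}(N,M)$ is the supremum of all $\alpha\in(0,1]$ for which some $a\in C^\infty([-A,A]^M,\mathbb{R}^N)$ satisfies this condition with exponent $\alpha$. Condition $(\gamma ND)$: for a positive integer $\gamma$, $a\in C^\infty(\mathbb{R}^M,\mathbb{R}^N)$ and $F\in\mathbb{R}^M\setminus\{0\}$, the condition is that for all $v\in\mathbb{R}^M$ and $\sigma=(\sigma_0,\widetilde\sigma)\in S^N$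 ($\sigma_0\in\mathbb{R}$, $\widetilde\sigma\in\mathbb{R}^N$), $|\sigma_0+a(v)\cdot\widetilde\sigma|+\sum_{k=1}^{\gamma-1}|(F\cdot\nabla_v)^k a(v)\cdot\widetilde\sigma|>0$, where $F\cdot\nabla_v=\sum_{i=1}^M F_i\partial_{v_i}$. $\gamma_{opt}(N,M)$ is the minimum of all positive integers $\gamma$ for which there exist $a\in C^\infty(\mathbb{R}^M,\mathbb{R}^N)$ and $F\in\mathbb{R}^M\setminus\{0\}$ satisfying $(\gamma ND)$. The exponents $\alpha/2$ and $1/\gamma$ are the orders of Sobolev regularity of velocity averages obtained under these two conditions, respectively. *)

theory Defs
  imports "HOL-Analysis.Analysis"
begin

text \<open>
  Derivatives are taken within \<open>S\<close>, so that on a closed cube they are one-sided at the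
  boundary; they are unique there because the cube is convex with nonempty interior.
\<close>

primrec Ck_on :: "nat \<Rightarrow> 'a::euclidean_space set \<Rightarrow> ('a \<Rightarrow> 'b::real_normed_vector) \<Rightarrow> bool" where
  "Ck_on 0 S f \<longleftrightarrow> continuous_on S f"
| "Ck_on (Suc k) S f \<longleftrightarrow>
     (\<exists>f'. (\<forall>x\<in>S. (f has_derivative f' x) (at x within S)) \<and> (\<forall>h. Ck_on k S (\<lambda>x. f' x h)))"

definition smooth_on :: "'a::euclidean_space set \<Rightarrow> ('a \<Rightarrow> 'b::real_normed_vector) \<Rightarrow> bool" where
  "smooth_on S f \<longleftrightarrow> (\<forall>k. Ck_on k S f)"

definition cube :: "real \<Rightarrow> (real ^ 'm) set" where
  "cube A = cbox (\<chi> i. - A) (\<chi> i. A)"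

text \<open>
  The norm on \<open>real \<times> (real ^ 'n)\<close> is Euclidean, so \<open>sphere 0 1\<close> is the unit sphere $S^N$. The set
  being measured is relatively open in the cube, hence Borel, for every continuous \<open>a\<close>; only
  such fields are considered below.
\<close>

definition measure_nondegenerate :: "real \<Rightarrow> (real ^ 'm \<Rightarrow> real ^ 'n) \<Rightarrow> real \<Rightarrow> bool" where
  "measure_nondegenerate A a \<alpha> \<longleftrightarrow>
     (\<exists>C>0. \<forall>(u, \<sigma>) \<in> sphere (0 :: real \<times> (real ^ 'n)) 1. \<forall>\<epsilon>>0.
        measure lebesgue {v \<in> cube A. u - \<epsilon> < a v \<bullet> \<sigma> \<and> a v \<bullet> \<sigma> < u + \<epsilon>} \<le> C * \<epsilon> powr \<alpha>)"

text \<open>The two type arguments carry the dimensions \<open>N = CARD('n)\<close> and \<open>M = CARD('m)\<close>.\<close>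

definition alpha_opt :: "real \<Rightarrow> 'n::finite itself \<Rightarrow> 'm::finite itself \<Rightarrow> real" where
  "alpha_opt A _ _ =
     Sup {\<alpha>. 0 < \<alpha> \<and> \<alpha> \<le> 1 \<and>
       (\<exists>a :: real ^ 'm \<Rightarrow> real ^ 'n. smooth_on (cube A) a \<and> measure_nondegenerate A a \<alpha>)}"

definition partial_deriv :: "'m::finite \<Rightarrow> (real ^ 'm \<Rightarrow> real ^ 'n) \<Rightarrow> real ^ 'm \<Rightarrow> real ^ 'n" where
  "partial_deriv i f v = vector_derivative (\<lambda>t. f (v + t *\<^sub>R axis i 1)) (at 0)"

text \<open>The operator $F \cdot \nabla_v$.\<close>

definition directional_deriv ::
    "real ^ 'm \<Rightarrow> (real ^ 'm \<Rightarrow> real ^ 'n) \<Rightarrow> real ^ 'm \<Rightarrow> real ^ 'n" where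
  "directional_deriv F f v = (\<Sum>i\<in>UNIV. (F $ i) *\<^sub>R partial_deriv i f v)"

definition gamma_nondegenerate ::
    "nat \<Rightarrow> (real ^ 'm \<Rightarrow> real ^ 'n) \<Rightarrow> real ^ 'm \<Rightarrow> bool" where
  "gamma_nondegenerate \<gamma> a F \<longleftrightarrow>
     (\<forall>v. \<forall>(\<sigma>\<^sub>0, \<sigma>) \<in> sphere (0 :: real \<times> (real ^ 'n)) 1.
        \<bar>\<sigma>\<^sub>0 + a v \<bullet> \<sigma>\<bar> + (\<Sum>k = 1..\<gamma> - 1. \<bar>(directional_deriv F ^^ k) a v \<bullet> \<sigma>\<bar>) > 0)"

definition gamma_opt :: "'n::finite itself \<Rightarrow> 'm::finite itself \<Rightarrow> nat" where
  "gamma_opt _ _ =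
     (LEAST \<gamma>. \<gamma> \<ge> 1 \<and>
       (\<exists>(a :: real ^ 'm \<Rightarrow> real ^ 'n) F. smooth_on UNIV a \<and> F \<noteq> 0 \<and> gamma_nondegenerate \<gamma> a F))"

end

theory Submission
  imports Defs
begin

text \<open>
  All the extremal values come from the moment curve $v \mapsto (v, v^2, \dots, v^N)$ for $M = 1$ and
  from the identity field for $M = N$. On the line their optimality comes from counting linear
  conditions on $\sigma$; for $M = N$ the exponent $1$ is the largest one admitted.

  For the moment curve, $\sigma_0 + a(v) \cdot \sigma$ is the polynomial in $v$ with coefficients
  $(\sigma_0, \sigma)$, an arbitrary nonzero polynomial of degree at most $N$. It cannot vanish
  together with $N$ derivatives at a point, so $\gamma = N + 1$ works. For no field can $\gamma$ be
  smaller: fewer than $N$ derivatives at a point have a common normal vector $\sigma \neq 0$, and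
  $\sigma_0$ is then chosen to cancel $a(v) \cdot \sigma$ (\<open>not_gamma_nondegenerate\<close>).

  The exponent $\alpha$ rests on the same dichotomy made quantitative. A polynomial of degree at most
  $N$ with coefficients of size one can be smaller than $\varepsilon$ on $[-A, A]$ only on a set of
  measure $O(\varepsilon^{1/N})$, uniformly in the polynomial (\<open>poly_sublevel_measure\<close>), so
  $\alpha = 1/N$ is attained. Conversely, for any smooth curve a vector $\sigma$ normal to the first
  $N - 1$ derivatives at $0$ makes $a(v) \cdot \sigma - a(0) \cdot \sigma = O(|v|^N)$ by Taylor's
  formula, and the sublevel set then contains an interval of length comparable to
  $\varepsilon^{1/N}$ (\<open>measure_nondegenerate_exponent_le\<close>). Hence $\gamma_{opt} = N + 1$ and
  $\alpha_{opt} = 1/N$ on the line, and $1/(N + 1) > 1/(2N)$ exactly when $N > 1$.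

  For the identity field the sublevel set is the part of the cube in a slab of width
  $2 \varepsilon / |\sigma|$ (\<open>measure_slab_le\<close>), of measure $O(\varepsilon / |\sigma|)$. This suffices unless $|\sigma|$ is
  small, and then $|u|$ is close to $1$ and the slab misses the cube for small $\varepsilon$.
\<close>

section \<open>Measurable subsets of the cube, and normal vectors\<close>

lemma mem_cube: "v \<in> cube A \<longleftrightarrow> (\<forall>i. \<bar>v $ i\<bar> \<le> A)"
  unfolding cube_def by (auto simp: mem_box_cart abs_le_iff minus_le_iff)

lemma norm_le_on_cube:
  fixes v :: "real ^ 'm"
  assumes "v \<in> cube A"
  shows "norm v \<le> real CARD('m) * A"
proof -
  have "norm v \<le> (\<Sum>i\<in>UNIV. \<bar>v $ i\<bar>)"
    by (rule norm_le_l1_cart)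
  also have "\<dots> \<le> real CARD('m) * A"
    using assms by (intro sum_bounded_above) (auto simp: mem_cube)
  finally show ?thesis .
qed

lemma lmeasurable_strip:
  fixes f :: "real ^ 'm \<Rightarrow> real"
  assumes "continuous_on (cube A) f"
  shows "{v \<in> cube A. l < f v \<and> f v < r} \<in> lmeasurable"
proof -
  have "openin (top_of_set (cube A)) (cube A \<inter> f -` {l<..<r})"
    using assms by (intro continuous_openin_preimage_gen) auto
  then obtain T where T: "open T" "cube A \<inter> f -` {l<..<r} = cube A \<inter> T"
    by (auto simp: openin_open)
  have "cube A \<inter> T \<in> lmeasurable"
    using T(1) by (intro fmeasurable_Int_fmeasurable) (auto simp: cube_def)
  moreover have "{v \<in> cube A. l < f v \<and> f v < r} = cube A \<inter> f -` {l<..<r}"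
    by auto
  ultimately show ?thesis
    by (simp add: T(2))
qed

lemma measure_interval_1:
  fixes x y :: real
  assumes "x \<le> y"
  shows "measure lebesgue {v :: real ^ 1. x \<le> v $ 1 \<and> v $ 1 \<le> y} = y - x"
    and "{v :: real ^ 1. x \<le> v $ 1 \<and> v $ 1 \<le> y} \<in> lmeasurable"
proof -
  have eq: "{v :: real ^ 1. x \<le> v $ 1 \<and> v $ 1 \<le> y} = cbox (\<chi> i. x) (\<chi> i. y)"
    by (auto simp: mem_box_cart)
  have "cbox (\<chi> i. x) (\<chi> i. y) \<noteq> ({} :: (real ^ 1) set)"
    using assms by (auto simp: interval_ne_empty_cart)
  then show "measure lebesgue {v :: real ^ 1. x \<le> v $ 1 \<and> v $ 1 \<le> y} = y - x"
    unfolding eq by (simp add: content_cbox_cart)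
  show "{v :: real ^ 1. x \<le> v $ 1 \<and> v $ 1 \<le> y} \<in> lmeasurable"
    unfolding eq by simp
qed

text \<open>
  Fewer than $N$ vectors of $\mathbb{R}^N$ have a common nonzero normal. Scaling it puts it on the
  sphere together with the level it takes at $x$, which is the form in which both
  non-degeneracy conditions are refuted.
\<close>

lemma sphere_normal_vector:
  fixes x :: "real ^ 'n" and B :: "(real ^ 'n) set"
  assumes "finite B" "card B < CARD('n)"
  obtains \<sigma> where "(x \<bullet> \<sigma>, \<sigma>) \<in> sphere (0 :: real \<times> (real ^ 'n)) 1" "\<And>b. b \<in> B \<Longrightarrow> b \<bullet> \<sigma> = 0"
proof -
  have "dim B < DIM(real ^ 'n)"
    using dim_le_card'[OF assms(1)] assms(2) by simp
  from lowdim_subset_hyperplane[OF this] obtain \<tau> :: "real ^ 'n"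
    where \<tau>: "\<tau> \<noteq> 0" "span B \<subseteq> {y. \<tau> \<bullet> y = 0}" by blast
  define r where "r = norm (x \<bullet> \<tau>, \<tau>)"
  have r: "r > 0"
    unfolding r_def using \<tau>(1) by (simp only: zero_less_norm_iff) (auto simp: zero_prod_def)
  show ?thesis
  proof
    have "(x \<bullet> (\<tau> /\<^sub>R r), \<tau> /\<^sub>R r) = (x \<bullet> \<tau>, \<tau>) /\<^sub>R r"
      by simp
    moreover have "norm ((x \<bullet> \<tau>, \<tau>) /\<^sub>R r) = 1"
      using r unfolding r_def by (simp only: norm_scaleR) simp
    ultimately show "(x \<bullet> (\<tau> /\<^sub>R r), \<tau> /\<^sub>R r) \<in> sphere (0 :: real \<times> (real ^ 'n)) 1"
      by (simp only: mem_sphere_0)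
    show "b \<bullet> (\<tau> /\<^sub>R r) = 0" if "b \<in> B" for b
      using \<tau>(2) span_base[OF that] by (auto simp: inner_commute)
  qed
qed


section \<open>Polynomial curves\<close>

definition poly_curve :: "('n \<Rightarrow> real poly) \<Rightarrow> real ^ 1 \<Rightarrow> real ^ 'n" where
  "poly_curve p v = (\<chi> i. poly (p i) (v $ 1))"

lemma inner_poly_curve:
  "poly_curve p v \<bullet> \<sigma> = poly (\<Sum>i\<in>UNIV. smult (\<sigma> $ i) (p i)) (v $ 1)"
  by (simp add: poly_curve_def inner_vec_def poly_sum mult.commute)

lemma has_derivative_poly_curve:
  "(poly_curve p has_derivative (\<lambda>h. poly_curve (\<lambda>i. smult (h $ 1) (pderiv (p i))) x)) (at x within S)"
proof -
  have "((\<lambda>v. poly (p i) (v $ 1)) has_derivative (\<lambda>h. (h $ 1) * poly (pderiv (p i)) (x $ 1)))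
      (at x within S)" for i
    using has_derivative_compose[OF bounded_linear_imp_has_derivative[OF bounded_linear_vec_nth[of 1]]
        poly_DERIV[of "p i" "x $ 1", unfolded has_field_derivative_def]]
    by (simp add: mult.commute)
  then show ?thesis
    unfolding poly_curve_def
    by (subst has_derivative_componentwise_within)
       (auto simp: Basis_vec_def inner_axis)
qed

text \<open>
  The directional derivatives of a polynomial curve are polynomial curves again, so the induction
  over the order of differentiability closes up for all polynomial curves at once.
\<close>

lemma smooth_on_poly_curve: "smooth_on S (poly_curve p)"
proof -
  have "Ck_on k S (poly_curve p)" for k
  proof (induction k arbitrary: p)
    case 0
    show ?case
      by (auto intro!: has_derivative_continuous_on has_derivative_poly_curve)
  next
    case (Suc k)
    show ?case
      unfolding Ck_on.simps
      by (rule exI[of _ "\<lambda>x h. poly_curve (\<lambda>i. smult (h $ 1) (pderiv (p i))) x"])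
        (use Suc.IH has_derivative_poly_curve in auto)
  qed
  then show ?thesis
    by (simp add: smooth_on_def)
qed

lemma directional_deriv_poly_curve:
  "(directional_deriv (axis 1 1) ^^ k) (poly_curve p) = poly_curve (\<lambda>i. (pderiv ^^ k) (p i))"
proof (induction k)
  case (Suc k)
  have "directional_deriv (axis 1 1) (poly_curve q) = poly_curve (\<lambda>i. pderiv (q i))"
    for q :: "'a \<Rightarrow> real poly"
  proof (rule ext)
    fix v :: "real ^ 1"
    have "((\<lambda>t. v + t *\<^sub>R axis 1 1) has_vector_derivative axis 1 1) (at 0)"
      by (auto intro!: derivative_eq_intros)
    from has_derivative_compose[OF this[unfolded has_vector_derivative_def]
        has_derivative_poly_curve[of q _ UNIV]]
    have "((\<lambda>t. poly_curve q (v + t *\<^sub>R axis 1 1)) has_vector_derivative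
        poly_curve (\<lambda>i. pderiv (q i)) v) (at 0)"
      unfolding has_vector_derivative_def
      by (rule has_derivative_eq_rhs) (simp add: fun_eq_iff poly_curve_def vec_eq_iff)
    then show "directional_deriv (axis 1 1) (poly_curve q) v = poly_curve (\<lambda>i. pderiv (q i)) v"
      by (simp add: directional_deriv_def partial_deriv_def vector_derivative_at)
  qed
  with Suc show ?case
    by simp
qed simp

text \<open>
  The coordinates are indexed by an arbitrary finite type, so the exponents $1, \dots, N$ are
  distributed over them by a bijection \<open>e\<close>.
\<close>

definition moment_curve :: "('n \<Rightarrow> nat) \<Rightarrow> real ^ 1 \<Rightarrow> real ^ 'n" where
  "moment_curve e = poly_curve (\<lambda>i. monom 1 (e i))"

definition moment_poly :: "('n::finite \<Rightarrow> nat) \<Rightarrow> real \<Rightarrow> real ^ 'n \<Rightarrow> real poly" where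
  "moment_poly e c \<sigma> = [:c:] + (\<Sum>i\<in>UNIV. smult (\<sigma> $ i) (monom 1 (e i)))"

lemma poly_moment_poly:
  "poly (moment_poly e c \<sigma>) (v $ 1) = c + moment_curve e v \<bullet> \<sigma>"
  by (simp add: moment_poly_def moment_curve_def inner_poly_curve)

lemma degree_moment_poly:
  fixes e :: "'n::finite \<Rightarrow> nat"
  assumes "bij_betw e UNIV {1..CARD('n)}"
  shows "degree (moment_poly e c \<sigma>) \<le> CARD('n)"
proof -
  have "e i \<le> CARD('n)" for i
    using bij_betwE[OF assms] by auto
  then show ?thesis
    unfolding moment_poly_def
    by (intro degree_add_le degree_sum_le) (auto intro!: order_trans[OF degree_smult_le] order_trans[OF degree_monom_le])
qed

lemma coeff_moment_poly:
  fixes e :: "'n::finite \<Rightarrow> nat"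
  assumes "bij_betw e UNIV {1..CARD('n)}"
  shows "coeff (moment_poly e c \<sigma>) 0 = c"
    and "coeff (moment_poly e c \<sigma>) (e i) = \<sigma> $ i"
proof -
  have e: "e i \<noteq> 0" for i
    using bij_betwE[OF assms] by (metis UNIV_I atLeastAtMost_iff not_one_le_zero)
  have inj: "e j = e i \<longleftrightarrow> j = i" for i j
    using assms by (auto simp: bij_betw_def inj_on_def)
  show "coeff (moment_poly e c \<sigma>) 0 = c"
  proof -
    have "(\<Sum>i\<in>UNIV. coeff (smult (\<sigma> $ i) (monom 1 (e i))) 0) = 0"
    proof (intro sum.neutral ballI)
      show "coeff (smult (\<sigma> $ i) (monom 1 (e i))) 0 = 0" for i
        using e[of i] by simp
    qed
    then show ?thesis
      by (simp only: moment_poly_def coeff_add coeff_sum) simp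
  qed
  show "coeff (moment_poly e c \<sigma>) (e i) = \<sigma> $ i"
    using e[of i] by (simp add: moment_poly_def coeff_sum coeff_pCons inj if_distrib[of "(*) _"] 
        sum.delta' split: nat.split cong: if_cong)
qed

lemma exists_exponents: "\<exists>e :: 'n::finite \<Rightarrow> nat. bij_betw e UNIV {1..CARD('n)}"
  using ex_bij_betw_nat_finite_1[of "UNIV :: 'n set"] by (auto intro: bij_betw_inv_into)


section \<open>Vanishing to order $N + 1$\<close>

lemma poly_eq_0_if_higher_pderivs_vanish:
  fixes p :: "real poly"
  assumes "degree p \<le> n" "\<And>k. k \<le> n \<Longrightarrow> poly ((pderiv ^^ k) p) x = 0"
  shows "p = 0"
  using assms
proof (induction n arbitrary: p)
  case 0
  then show ?case
    using Suc_leI by (auto elim!: degree_eq_zeroE)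
next
  case (Suc n)
  have "pderiv p = 0"
  proof (rule Suc.IH)
    show "degree (pderiv p) \<le> n"
      using Suc.prems(1) by (simp add: degree_pderiv)
    show "poly ((pderiv ^^ k) (pderiv p)) x = 0" if "k \<le> n" for k
      using Suc.prems(2)[of "Suc k"] that by (simp only: funpow_Suc_right o_apply Suc_le_mono)
  qed
  then obtain c where "p = [:c:]"
    by (metis pderiv_eq_0_iff degree_eq_zeroE)
  then show ?case
    using Suc.prems(2)[of 0] by simp
qed

text \<open>The constant coefficient is free because differentiating removes it.\<close>

lemma directional_deriv_moment_curve:
  assumes "k \<ge> 1"
  shows "(directional_deriv (axis 1 1) ^^ k) (moment_curve e) v \<bullet> \<sigma>
    = poly ((pderiv ^^ k) (moment_poly e c \<sigma>)) (v $ 1)"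
proof -
  have "(pderiv ^^ k) [:c:] = 0"
    using assms by (cases k) (simp_all del: funpow.simps add: funpow_Suc_right pderiv_pCons)
  then show ?thesis
    by (simp add: moment_curve_def directional_deriv_poly_curve inner_poly_curve moment_poly_def
        higher_pderiv_add higher_pderiv_sum higher_pderiv_smult)
qed

text \<open>
  If every term of the sum were zero, the polynomial with coefficients $(\sigma_0, \sigma)$ would
  vanish to order $N + 1$ at a point, hence identically, and $(\sigma_0, \sigma)$ would be $0$.
\<close>

lemma gamma_nondegenerate_moment_curve:
  fixes e :: "'n::finite \<Rightarrow> nat"
  assumes e: "bij_betw e UNIV {1..CARD('n)}"
  shows "gamma_nondegenerate (CARD('n) + 1) (moment_curve e) (axis 1 1)"
  unfolding gamma_nondegenerate_def
proof (intro allI ballI, clarify)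
  fix v :: "real ^ 1" and \<sigma>\<^sub>0 :: real and \<sigma> :: "real ^ 'n"
  assume sph: "(\<sigma>\<^sub>0, \<sigma>) \<in> sphere 0 1"
  let ?P = "moment_poly e \<sigma>\<^sub>0 \<sigma>"
  let ?T = "\<lambda>k. (directional_deriv (axis 1 1) ^^ k) (moment_curve e) v \<bullet> \<sigma>"
  show "\<bar>\<sigma>\<^sub>0 + moment_curve e v \<bullet> \<sigma>\<bar> + (\<Sum>k = 1..CARD('n) + 1 - 1. \<bar>?T k\<bar>) > 0"
  proof (rule ccontr)
    assume "\<not> ?thesis"
    moreover have "(\<Sum>k = 1..CARD('n) + 1 - 1. \<bar>?T k\<bar>) \<ge> 0"
      by (intro sum_nonneg) auto
    ultimately have "\<bar>\<sigma>\<^sub>0 + moment_curve e v \<bullet> \<sigma>\<bar> = 0" and "(\<Sum>k = 1..CARD('n) + 1 - 1. \<bar>?T k\<bar>) = 0"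
      by linarith+
    then have "poly ((pderiv ^^ k) ?P) (v $ 1) = 0" if "k \<le> CARD('n)" for k
      using that
      by (cases "k = 0")
         (auto simp: poly_moment_poly sum_nonneg_eq_0_iff directional_deriv_moment_curve[of _ e v \<sigma> \<sigma>\<^sub>0])
    with degree_moment_poly[OF e] have "?P = 0"
      by (rule poly_eq_0_if_higher_pderivs_vanish)
    then have "\<sigma>\<^sub>0 = 0" "\<sigma> = 0"
      using coeff_moment_poly[OF e, of \<sigma>\<^sub>0 \<sigma>] by (auto simp: vec_eq_iff)
    then show False
      using sph by simp
  qed
qed

text \<open>
  Degeneracy at the single point $0$ is forced by counting: the condition involves at most $N - 1$
  derivatives of $a$ there, and $\sigma_0$ cancels the term of order zero.
\<close>

lemma not_gamma_nondegenerate: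
  fixes a :: "real ^ 'm \<Rightarrow> real ^ 'n"
  assumes "\<gamma> \<le> CARD('n)"
  shows "\<not> gamma_nondegenerate \<gamma> a F"
proof
  assume nd: "gamma_nondegenerate \<gamma> a F"
  let ?B = "(\<lambda>k. (directional_deriv F ^^ k) a 0) ` {1..\<gamma> - 1}"
  have "card ?B \<le> \<gamma> - 1"
    using card_image_le[of "{1..\<gamma> - 1}"] by simp
  also have "\<gamma> - 1 < CARD('n)"
    using assms zero_less_card_finite[where 'a='n] by linarith
  finally obtain \<sigma> where \<sigma>: "(a 0 \<bullet> \<sigma>, \<sigma>) \<in> sphere (0 :: real \<times> (real ^ 'n)) 1"
      "\<And>b. b \<in> ?B \<Longrightarrow> b \<bullet> \<sigma> = 0"
    by (rule sphere_normal_vector[rotated]) auto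
  have "(- (a 0 \<bullet> \<sigma>), \<sigma>) \<in> sphere (0 :: real \<times> (real ^ 'n)) 1"
    using \<sigma>(1) by (simp add: norm_Pair)
  with nd have "\<bar>- (a 0 \<bullet> \<sigma>) + a 0 \<bullet> \<sigma>\<bar> + (\<Sum>k = 1..\<gamma> - 1. \<bar>(directional_deriv F ^^ k) a 0 \<bullet> \<sigma>\<bar>) > 0"
    unfolding gamma_nondegenerate_def by fast
  with \<sigma>(2) show False
    by simp
qed

theorem gamma_opt_line: "gamma_opt TYPE('n::finite) TYPE(1) = CARD('n) + 1"
  unfolding gamma_opt_def
proof (rule Least_equality)
  obtain e :: "'n \<Rightarrow> nat" where e: "bij_betw e UNIV {1..CARD('n)}"
    using exists_exponents by blast
  have "smooth_on UNIV (moment_curve e)"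
    by (simp add: moment_curve_def smooth_on_poly_curve)
  with gamma_nondegenerate_moment_curve[OF e]
  show "CARD('n) + 1 \<ge> 1 \<and> (\<exists>(a :: real ^ 1 \<Rightarrow> real ^ 'n) F.
      smooth_on UNIV a \<and> F \<noteq> 0 \<and> gamma_nondegenerate (CARD('n) + 1) a F)"
    by (metis axis_eq_0_iff le_add2 zero_neq_one)
next
  fix \<gamma>
  assume "\<gamma> \<ge> 1 \<and> (\<exists>(a :: real ^ 1 \<Rightarrow> real ^ 'n) F.
      smooth_on UNIV a \<and> F \<noteq> 0 \<and> gamma_nondegenerate \<gamma> a F)"
  then show "CARD('n) + 1 \<le> \<gamma>"
    using not_gamma_nondegenerate[of \<gamma>] by (metis Suc_eq_plus1 not_less_eq_eq)
qed


section \<open>Sublevel sets of polynomials\<close>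

text \<open>
  Dividing out a linear factor $X - x$ loses at most a bounded factor in the size of the
  coefficients, provided that the remainder $p(x)$ is small. This is what makes the constant in the
  next estimate uniform in the polynomial.
\<close>

lemma synthetic_div_coeff_sum:
  fixes p :: "real poly"
  assumes "degree p \<le> Suc n"
  shows "(\<Sum>i\<le>Suc n. \<bar>coeff p i\<bar>)
    \<le> \<bar>poly p x\<bar> + (1 + \<bar>x\<bar>) * (\<Sum>i\<le>n. \<bar>coeff (synthetic_div p x) i\<bar>)"
proof -
  let ?q = "synthetic_div p x"
  have p: "p = [:- x, 1:] * ?q + [:poly p x:]"
    by (rule synthetic_div_correct'[symmetric])
  have "degree ?q \<le> n"
    using assms by (simp add: degree_synthetic_div)
  then have q: "coeff ?q (Suc n) = 0"
    by (intro coeff_eq_0) simp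
  have "coeff p 0 = poly p x - x * coeff ?q 0"
    by (subst p) simp
  then have c0: "\<bar>coeff p 0\<bar> \<le> \<bar>poly p x\<bar> + \<bar>x\<bar> * \<bar>coeff ?q 0\<bar>"
    by (simp add: abs_mult[symmetric])
  have "coeff p (Suc i) = coeff ?q i - x * coeff ?q (Suc i)" for i
    by (subst p) (simp add: coeff_pCons)
  then have "\<bar>coeff p (Suc i)\<bar> \<le> \<bar>coeff ?q i\<bar> + \<bar>x\<bar> * \<bar>coeff ?q (Suc i)\<bar>" for i
    by (simp add: abs_mult[symmetric])
  then have "(\<Sum>i\<le>n. \<bar>coeff p (Suc i)\<bar>) \<le> (\<Sum>i\<le>n. \<bar>coeff ?q i\<bar> + \<bar>x\<bar> * \<bar>coeff ?q (Suc i)\<bar>)"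
    by (intro sum_mono)
  also have "\<dots> = (\<Sum>i\<le>n. \<bar>coeff ?q i\<bar>) + \<bar>x\<bar> * (\<Sum>i\<le>n. \<bar>coeff ?q (Suc i)\<bar>)"
    by (simp add: sum.distrib sum_distrib_left)
  finally have "(\<Sum>i\<le>Suc n. \<bar>coeff p i\<bar>)
      \<le> \<bar>poly p x\<bar> + (\<Sum>i\<le>n. \<bar>coeff ?q i\<bar>) + \<bar>x\<bar> * (\<bar>coeff ?q 0\<bar> + (\<Sum>i\<le>n. \<bar>coeff ?q (Suc i)\<bar>))"
    using c0 by (simp add: sum.atMost_Suc_shift algebra_simps del: sum.atMost_Suc)
  also have "\<bar>coeff ?q 0\<bar> + (\<Sum>i\<le>n. \<bar>coeff ?q (Suc i)\<bar>) = (\<Sum>i\<le>n. \<bar>coeff ?q i\<bar>)"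
    using sum.atMost_Suc_shift[of "\<lambda>i. \<bar>coeff ?q i\<bar>" n] q by simp
  finally show ?thesis
    by (simp add: algebra_simps)
qed

lemma lmeasurable_poly_sublevel:
  "{v \<in> cube A :: (real ^ 1) set. \<bar>poly p (v $ 1)\<bar> < \<epsilon>} \<in> lmeasurable"
proof -
  have "continuous_on (cube A) (\<lambda>v :: real ^ 1. poly p (v $ 1))"
    by (intro continuous_intros)
  from lmeasurable_strip[OF this, of "- \<epsilon>" \<epsilon>] show ?thesis
    by (rule back_subst[of "\<lambda>S. S \<in> lmeasurable"]) auto
qed

text \<open>
  Write $m$ for the measure of $E = \{|p| < \varepsilon\}$ and $s$ for the sum of the absolute values
  of the coefficients; the claim is $s\, m^n \le C \varepsilon$, with $C$ depending on $A$ and $n$ only.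
  In the induction step pick $x \in E$ and write $p = p(x) + (X - x) q$. At points of $E$ farther than
  $\delta = m/4$ from $x$ one has $|q| < 2 \varepsilon / \delta$. Those points fill at least half of
  $E$, since the excluded interval has length $m/2$, and the induction hypothesis for $q$ gives the
  claim. Nonemptiness of $E$ is required for $n = 0$, where $m^0 = 1$ carries no information about $E$.
\<close>

lemma poly_sublevel_measure:
  assumes "A > 0"
  shows "\<exists>C>0. \<forall>p \<epsilon>. degree p \<le> n \<longrightarrow> {v \<in> cube A :: (real ^ 1) set. \<bar>poly p (v $ 1)\<bar> < \<epsilon>} \<noteq> {} \<longrightarrow>
    (\<Sum>i\<le>n. \<bar>coeff p i\<bar>)
      * measure lebesgue {v \<in> cube A :: (real ^ 1) set. \<bar>poly p (v $ 1)\<bar> < \<epsilon>} ^ n \<le> C * \<epsilon>"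
proof (induction n)
  case 0
  have "\<bar>coeff p 0\<bar> \<le> \<epsilon>" if "degree p = 0" "\<bar>poly p x\<bar> < \<epsilon>" for p :: "real poly" and \<epsilon> x
    using that by (auto elim!: degree_eq_zeroE)
  then show ?case
    by (intro exI[of _ 1]) auto
next
  case (Suc n)
  let ?E = "\<lambda>p \<epsilon>. {v \<in> cube A :: (real ^ 1) set. \<bar>poly p (v $ 1)\<bar> < \<epsilon>}"
  let ?s = "\<lambda>n p. \<Sum>i\<le>n. \<bar>coeff p i\<bar> :: real"
  from Suc.IH obtain C where C: "C > 0"
    "\<And>p \<epsilon>. degree p \<le> n \<Longrightarrow> ?E p \<epsilon> \<noteq> {} \<Longrightarrow> ?s n p * measure lebesgue (?E p \<epsilon>) ^ n \<le> C * \<epsilon>"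
    by blast
  define K where "K = (2 * A) ^ Suc n + (1 + A) * 2 ^ n * 8 * C"
  have K: "K > 0"
    unfolding K_def using assms C(1) by (intro add_pos_pos) auto
  have cube: "measure lebesgue (cube A :: (real ^ 1) set) = 2 * A" 
    and cube': "(cube A :: (real ^ 1) set) \<in> lmeasurable"
    using measure_interval_1[of "- A" A] assms by (simp_all add: cube_def cbox_def Basis_vec_def inner_axis)
  have "?s (Suc n) p * measure lebesgue (?E p \<epsilon>) ^ Suc n \<le> K * \<epsilon>"
    if p: "degree p \<le> Suc n" "?E p \<epsilon> \<noteq> {}" for p \<epsilon>
  proof -
    let ?m = "measure lebesgue (?E p \<epsilon>)"
    from p(2) obtain v\<^sub>0 :: "real ^ 1" where v\<^sub>0: "v\<^sub>0 \<in> cube A" "\<bar>poly p (v\<^sub>0 $ 1)\<bar> < \<epsilon>"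
      by blast
    define x where "x = v\<^sub>0 $ 1"
    have x: "\<bar>x\<bar> \<le> A" "\<bar>poly p x\<bar> < \<epsilon>"
      using v\<^sub>0 by (auto simp: x_def mem_cube)
    have \<epsilon>: "\<epsilon> > 0"
      using x(2) by linarith
    let ?q = "synthetic_div p x"
    have m0: "?m \<ge> 0"
      by simp
    show ?thesis
    proof (cases "?m = 0")
      case True
      then show ?thesis
        using K \<epsilon> by simp
    next
      case False
      with m0 have m: "?m > 0"
        by linarith
      have m_le: "?m \<le> 2 * A"
        unfolding cube[symmetric]
        by (rule measure_mono_fmeasurable[OF _ fmeasurableD[OF lmeasurable_poly_sublevel] cube']) auto
      define \<delta> where "\<delta> = ?m / 4"
      have \<delta>: "\<delta> > 0"
        using m by (simp add: \<delta>_def)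
      let ?I = "{v :: real ^ 1. x - \<delta> \<le> v $ 1 \<and> v $ 1 \<le> x + \<delta>}"
      let ?Q = "?E ?q (2 * \<epsilon> / \<delta>)"
      have "?E p \<epsilon> \<subseteq> ?I \<union> ?Q"
      proof
        fix v assume v: "v \<in> ?E p \<epsilon>"
        let ?y = "v $ 1"
        have "poly p ?y = poly ([:- x, 1:] * ?q + [:poly p x:]) ?y"
          by (simp only: synthetic_div_correct')
        then have "(?y - x) * poly ?q ?y = poly p ?y - poly p x"
          by (simp add: algebra_simps)
        then have "\<bar>?y - x\<bar> * \<bar>poly ?q ?y\<bar> = \<bar>poly p ?y - poly p x\<bar>"
          by (simp add: abs_mult[symmetric])
        then have "\<bar>?y - x\<bar> * \<bar>poly ?q ?y\<bar> < 2 * \<epsilon>"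
          using v x(2) by (simp, linarith)
        moreover have "\<delta> * \<bar>poly ?q ?y\<bar> \<le> \<bar>?y - x\<bar> * \<bar>poly ?q ?y\<bar>" if "\<bar>?y - x\<bar> > \<delta>"
          using that by (intro mult_right_mono) auto
        ultimately have "\<bar>poly ?q ?y\<bar> < 2 * \<epsilon> / \<delta>" if "\<bar>?y - x\<bar> > \<delta>"
          using that \<delta> by (simp add: pos_less_divide_eq mult.commute)
        then show "v \<in> ?I \<union> ?Q"
          using v by (cases "\<bar>?y - x\<bar> > \<delta>") (auto simp: abs_le_iff not_less)
      qed
      then have "?m \<le> measure lebesgue (?I \<union> ?Q)"
        using \<delta> by (intro measure_mono_fmeasurable fmeasurable.Un measure_interval_1 lmeasurable_poly_sublevel
            fmeasurableD[OF lmeasurable_poly_sublevel]) auto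
      also have "\<dots> \<le> measure lebesgue ?I + measure lebesgue ?Q"
        using \<delta> by (intro measure_Un_le fmeasurableD measure_interval_1 lmeasurable_poly_sublevel) auto
      also have "measure lebesgue ?I = ?m / 2"
        using \<delta> by (subst measure_interval_1) (auto simp: \<delta>_def)
      finally have mQ: "?m / 2 \<le> measure lebesgue ?Q"
        by simp
      have "?Q \<noteq> {}"
      proof
        assume "?Q = {}"
        then show False using mQ m by (simp only: measure_empty)
      qed
      moreover have "degree ?q \<le> n"
        using p(1) by (simp add: degree_synthetic_div)
      ultimately have "?s n ?q * measure lebesgue ?Q ^ n \<le> C * (2 * \<epsilon> / \<delta>)"
        by (intro C(2))
      moreover have "?s n ?q * (?m / 2) ^ n \<le> ?s n ?q * measure lebesgue ?Q ^ n"
        using mQ by (intro mult_left_mono power_mono sum_nonneg) auto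
      ultimately have "?s n ?q * (?m / 2) ^ n \<le> C * (2 * \<epsilon> / \<delta>)"
        by linarith
      then have "?s n ?q * (?m / 2) ^ n * (2 ^ n * ?m) \<le> C * (2 * \<epsilon> / \<delta>) * (2 ^ n * ?m)"
        by (rule mult_right_mono) simp
      moreover have "?s n ?q * (?m / 2) ^ n * (2 ^ n * ?m) = ?s n ?q * ?m ^ Suc n"
        by (simp add: power_divide)
      moreover have "C * (2 * \<epsilon> / \<delta>) * (2 ^ n * ?m) = 2 ^ n * 8 * C * \<epsilon>"
        using m by (simp add: \<delta>_def)
      ultimately have q: "?s n ?q * ?m ^ Suc n \<le> 2 ^ n * 8 * C * \<epsilon>"
        by simp
      have "?s (Suc n) p \<le> \<bar>poly p x\<bar> + (1 + \<bar>x\<bar>) * ?s n ?q"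
        by (rule synthetic_div_coeff_sum[OF p(1)])
      also have "\<dots> \<le> \<epsilon> + (1 + A) * ?s n ?q"
        using x by (intro add_mono mult_right_mono sum_nonneg) auto
      finally have "?s (Suc n) p * ?m ^ Suc n \<le> (\<epsilon> + (1 + A) * ?s n ?q) * ?m ^ Suc n"
        by (rule mult_right_mono) simp
      also have "\<dots> = \<epsilon> * ?m ^ Suc n + (1 + A) * (?s n ?q * ?m ^ Suc n)"
        by (simp only: distrib_right mult.assoc)
      also have "\<dots> \<le> \<epsilon> * (2 * A) ^ Suc n + (1 + A) * (2 ^ n * 8 * C * \<epsilon>)"
        using q m_le m0 assms \<epsilon> by (intro add_mono mult_left_mono power_mono) auto
      also have "\<dots> = K * \<epsilon>"
        by (simp add: K_def algebra_simps)
      finally show ?thesis .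
    qed
  qed
  with K show ?case
    by blast
qed


section \<open>The measure condition for curves\<close>

theorem measure_nondegenerate_moment_curve:
  fixes e :: "'n::finite \<Rightarrow> nat"
  assumes "A > 0" and e: "bij_betw e UNIV {1..CARD('n)}"
  shows "measure_nondegenerate A (moment_curve e) (1 / real CARD('n))"
proof -
  let ?N = "CARD('n)"
  obtain C where C: "C > 0"
    "\<And>p \<epsilon>. degree p \<le> ?N \<Longrightarrow> {v \<in> cube A :: (real ^ 1) set. \<bar>poly p (v $ 1)\<bar> < \<epsilon>} \<noteq> {} \<Longrightarrow>
      (\<Sum>i\<le>?N. \<bar>coeff p i\<bar>)
        * measure lebesgue {v \<in> cube A :: (real ^ 1) set. \<bar>poly p (v $ 1)\<bar> < \<epsilon>} ^ ?N \<le> C * \<epsilon>"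
    using poly_sublevel_measure[OF assms(1), of ?N] by blast
  have "measure lebesgue {v \<in> cube A. u - \<epsilon> < moment_curve e v \<bullet> \<sigma> \<and> moment_curve e v \<bullet> \<sigma> < u + \<epsilon>}
      \<le> C powr (1 / real ?N) * \<epsilon> powr (1 / real ?N)"
    if sph: "(u, \<sigma>) \<in> sphere (0 :: real \<times> (real ^ 'n)) 1" and \<epsilon>: "\<epsilon> > 0" for u \<sigma> \<epsilon>
  proof -
    let ?P = "moment_poly e (- u) \<sigma>"
    let ?E = "{v \<in> cube A :: (real ^ 1) set. \<bar>poly ?P (v $ 1)\<bar> < \<epsilon>}"
    let ?m = "measure lebesgue ?E"
    have E: "{v \<in> cube A. u - \<epsilon> < moment_curve e v \<bullet> \<sigma> \<and> moment_curve e v \<bullet> \<sigma> < u + \<epsilon>} = ?E"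
      by (auto simp: poly_moment_poly abs_less_iff)
    have sum1: "(\<Sum>i\<le>?N. \<bar>coeff ?P i\<bar>) \<ge> 1"
    proof -
      have "1 = norm (u, \<sigma>)"
        using sph by simp
      also have "\<dots> \<le> \<bar>u\<bar> + norm \<sigma>"
        by (metis norm_Pair_le real_norm_def)
      also have "norm \<sigma> \<le> (\<Sum>i\<in>UNIV. \<bar>\<sigma> $ i\<bar>)"
        by (rule norm_le_l1_cart)
      also have "\<dots> = (\<Sum>i\<in>UNIV. \<bar>coeff ?P (e i)\<bar>)"
        by (simp add: coeff_moment_poly(2)[OF e])
      also have "\<dots> = (\<Sum>i=1..?N. \<bar>coeff ?P i\<bar>)"
        by (rule sum.reindex_bij_betw[OF e])
      also have "\<bar>u\<bar> + \<dots> = (\<Sum>i\<le>?N. \<bar>coeff ?P i\<bar>)"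
        by (simp add: atMost_atLeast0 sum.atLeast_Suc_atMost[of 0] coeff_moment_poly(1)[OF e])
      finally show ?thesis
        by simp
    qed
    have "?m \<le> (C * \<epsilon>) powr (1 / real ?N)"
    proof (cases "?m = 0")
      case False
      then have "?E \<noteq> {}"
        by (metis measure_empty)
      then have "(\<Sum>i\<le>?N. \<bar>coeff ?P i\<bar>) * ?m ^ ?N \<le> C * \<epsilon>"
        by (intro C(2) degree_moment_poly[OF e])
      moreover have "1 * ?m ^ ?N \<le> (\<Sum>i\<le>?N. \<bar>coeff ?P i\<bar>) * ?m ^ ?N"
        by (intro mult_right_mono sum1) auto
      ultimately have "?m ^ ?N \<le> C * \<epsilon>"
        by linarith
      then have "root ?N (?m ^ ?N) \<le> root ?N (C * \<epsilon>)"
        by simp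
      then show ?thesis
        using C(1) \<epsilon> by (simp add: real_root_power_cancel flip: root_powr_inverse)
    qed simp
    also have "\<dots> = C powr (1 / real ?N) * \<epsilon> powr (1 / real ?N)"
      using C(1) \<epsilon> by (simp add: powr_mult)
    finally show ?thesis
      unfolding E .
  qed
  then show ?thesis
    unfolding measure_nondegenerate_def using C(1) by (intro exI[of _ "C powr (1 / real ?N)"]) auto
qed

text \<open>
  On the line, the derivatives along the unit vector form a chain of ordinary vector derivatives
  in one real variable. At interior points of the cube they are two-sided, as Taylor's formula
  requires; at the end points only continuity is kept.
\<close>

lemma Ck_on_line_derivatives:
  fixes f :: "real ^ 1 \<Rightarrow> real ^ 'n"
  assumes "Ck_on k (cube A) f"
  shows "\<exists>D. D 0 = (\<lambda>t. f (t *\<^sub>R axis 1 1)) \<and> continuous_on {- A..A} (D k) \<and>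
    (\<forall>m<k. \<forall>t. \<bar>t\<bar> < A \<longrightarrow> (D m has_vector_derivative D (Suc m) t) (at t))"
  using assms
proof (induction k arbitrary: f)
  case 0
  then have "continuous_on (cube A) f"
    by simp
  moreover have "continuous_on {- A..A} (\<lambda>t. t *\<^sub>R axis 1 1 :: real ^ 1)"
    by (intro continuous_intros)
  moreover have "(\<lambda>t. t *\<^sub>R axis 1 1 :: real ^ 1) ` {- A..A} \<subseteq> cube A"
    by (auto simp: mem_cube)
  ultimately have "continuous_on {- A..A} (\<lambda>t. f (t *\<^sub>R axis 1 1))"
    by (rule continuous_on_compose2)
  then show ?case
    by (intro exI[of _ "\<lambda>_ t. f (t *\<^sub>R axis 1 1)"]) auto
next
  case (Suc k)
  from Suc.prems obtain f' where
    f': "\<And>x. x \<in> cube A \<Longrightarrow> (f has_derivative f' x) (at x within cube A)"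
      "\<And>h. Ck_on k (cube A) (\<lambda>x. f' x h)"
    by auto
  from Suc.IH[OF f'(2)[of "axis 1 1"]] obtain D where
    D: "D 0 = (\<lambda>t. f' (t *\<^sub>R axis 1 1) (axis 1 1))" "continuous_on {- A..A} (D k)"
      "\<And>m t. m < k \<Longrightarrow> \<bar>t\<bar> < A \<Longrightarrow> (D m has_vector_derivative D (Suc m) t) (at t)"
    by blast
  have step: "((\<lambda>t. f (t *\<^sub>R axis 1 1)) has_vector_derivative D 0 t) (at t)" if "\<bar>t\<bar> < A" for t
  proof -
    let ?x = "t *\<^sub>R axis 1 1 :: real ^ 1"
    have "?x \<in> interior (cube A)"
      using that by (auto simp: cube_def interior_cbox mem_box_cart)
    then have fd: "(f has_derivative f' ?x) (at ?x)"
      using f'(1)[of ?x] interior_subset by (metis at_within_interior subsetD)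
    have "((\<lambda>t. t *\<^sub>R axis 1 1 :: real ^ 1) has_derivative (\<lambda>h. h *\<^sub>R axis 1 1)) (at t)"
      by (auto intro!: derivative_eq_intros)
    from has_derivative_compose[OF this fd] show ?thesis
      unfolding has_vector_derivative_def D(1)
      by (rule has_derivative_eq_rhs)
         (simp add: fun_eq_iff linear_scale[OF has_derivative_linear[OF fd]])
  qed
  define D' where "D' m = (case m of 0 \<Rightarrow> \<lambda>t. f (t *\<^sub>R axis 1 1) | Suc m \<Rightarrow> D m)" for m
  have "(D' m has_vector_derivative D' (Suc m) t) (at t)" if "m < Suc k" "\<bar>t\<bar> < A" for m t
    using that step D(3) by (cases m) (auto simp: D'_def)
  moreover have "D' 0 = (\<lambda>t. f (t *\<^sub>R axis 1 1))" "continuous_on {- A..A} (D' (Suc k))"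
    using D(2) by (simp_all add: D'_def)
  ultimately show ?case
    by blast
qed

text \<open>
  Take $\sigma$ normal to the derivatives of order $1, \dots, N - 1$ at $0$ and $u = f(0) \cdot \sigma$.
  Then only the remainder of order $N$ survives in Taylor's formula for $f \cdot \sigma - u$. The
  bound is restricted to half of the cube to stay in its interior.
\<close>

lemma flat_functional_at_0:
  fixes f :: "real ^ 1 \<Rightarrow> real ^ 'n"
  assumes "A > 0" "Ck_on CARD('n) (cube A) f"
  obtains u \<sigma> K where "(u, \<sigma>) \<in> sphere (0 :: real \<times> (real ^ 'n)) 1" "K > 0"
    "\<And>v. \<bar>v $ 1\<bar> \<le> A / 2 \<Longrightarrow> \<bar>f v \<bullet> \<sigma> - u\<bar> \<le> K * \<bar>v $ 1\<bar> ^ CARD('n)"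
proof -
  let ?N = "CARD('n)"
  obtain D where D: "D 0 = (\<lambda>t. f (t *\<^sub>R axis 1 1))" "continuous_on {- A..A} (D ?N)"
      "\<And>m t. m < ?N \<Longrightarrow> \<bar>t\<bar> < A \<Longrightarrow> (D m has_vector_derivative D (Suc m) t) (at t)"
    using Ck_on_line_derivatives[OF assms(2)] by blast
  let ?B = "(\<lambda>m. D m 0) ` {1..?N - 1}"
  have "card ?B \<le> ?N - 1"
    using card_image_le[of "{1..?N - 1}" "\<lambda>m. D m 0"] by simp
  also have "?N - 1 < ?N"
    by simp
  finally obtain \<sigma> where \<sigma>: "(f 0 \<bullet> \<sigma>, \<sigma>) \<in> sphere (0 :: real \<times> (real ^ 'n)) 1"
      "\<And>b. b \<in> ?B \<Longrightarrow> b \<bullet> \<sigma> = 0"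
    by (rule sphere_normal_vector[rotated]) auto
  have "compact ((\<lambda>t. D ?N t \<bullet> \<sigma>) ` {- A..A})"
    by (intro compact_continuous_image continuous_intros D(2)) auto
  then obtain K where K: "K > 0" "\<forall>y\<in>(\<lambda>t. D ?N t \<bullet> \<sigma>) ` {- A..A}. norm y \<le> K"
    using compact_imp_bounded bounded_pos by metis
  have "\<bar>f v \<bullet> \<sigma> - f 0 \<bullet> \<sigma>\<bar> \<le> K * \<bar>v $ 1\<bar> ^ ?N" if v: "\<bar>v $ 1\<bar> \<le> A / 2" for v
  proof -
    let ?t = "v $ 1"
    have "\<forall>m t. m < ?N \<and> \<bar>t\<bar> \<le> \<bar>?t\<bar> \<longrightarrow> DERIV (\<lambda>t. D m t \<bullet> \<sigma>) t :> D (Suc m) t \<bullet> \<sigma>"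
    proof (intro allI impI)
      fix m t assume "m < ?N \<and> \<bar>t\<bar> \<le> \<bar>?t\<bar>"
      then have "(D m has_vector_derivative D (Suc m) t) (at t)"
        using v assms(1) by (intro D(3)) auto
      then show "DERIV (\<lambda>t. D m t \<bullet> \<sigma>) t :> D (Suc m) t \<bullet> \<sigma>"
        unfolding has_vector_derivative_def has_field_derivative_def
        by (auto intro!: derivative_eq_intros)
    qed
    from Maclaurin_bi_le[OF refl this] obtain s where s: "\<bar>s\<bar> \<le> \<bar>?t\<bar>"
        "D 0 ?t \<bullet> \<sigma> = (\<Sum>m<?N. D m 0 \<bullet> \<sigma> / fact m * ?t ^ m) + D ?N s \<bullet> \<sigma> / fact ?N * ?t ^ ?N"
      by blast
    have "(\<Sum>m<?N. D m 0 \<bullet> \<sigma> / fact m * ?t ^ m) = (\<Sum>m\<in>{0}. D m 0 \<bullet> \<sigma> / fact m * ?t ^ m)"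
    proof (intro sum.mono_neutral_right ballI)
      fix m assume "m \<in> {..<?N} - {0}"
      then have "D m 0 \<in> ?B"
        by (intro imageI) auto
      then show "D m 0 \<bullet> \<sigma> / fact m * ?t ^ m = 0"
        by (simp add: \<sigma>(2))
    qed auto
    also have "\<dots> = f 0 \<bullet> \<sigma>"
      by (simp add: D(1))
    finally have "(\<Sum>m<?N. D m 0 \<bullet> \<sigma> / fact m * ?t ^ m) = f 0 \<bullet> \<sigma>" .
    moreover have "?t *\<^sub>R axis 1 1 = v"
      by (simp add: vec_eq_iff)
    ultimately have "f v \<bullet> \<sigma> - f 0 \<bullet> \<sigma> = D ?N s \<bullet> \<sigma> / fact ?N * ?t ^ ?N"
      using s(2) by (simp add: D(1))
    then have "\<bar>f v \<bullet> \<sigma> - f 0 \<bullet> \<sigma>\<bar> = \<bar>D ?N s \<bullet> \<sigma>\<bar> / fact ?N * \<bar>?t\<bar> ^ ?N"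
      by (simp add: abs_mult power_abs)
    also have "\<bar>D ?N s \<bullet> \<sigma>\<bar> / fact ?N \<le> \<bar>D ?N s \<bullet> \<sigma>\<bar> / 1"
      by (intro divide_left_mono) auto
    also have "\<bar>D ?N s \<bullet> \<sigma>\<bar> / 1 \<le> K"
    proof -
      have "s \<in> {- A..A}"
        using s(1) v assms(1) by auto
      with K(2) show ?thesis
        by simp
    qed
    finally show ?thesis
      by (simp add: mult_right_mono)
  qed
  with \<sigma>(1) K(1) that show ?thesis
    by blast
qed

lemma powr_exponent_le_1:
  fixes C \<beta> r\<^sub>0 :: real
  assumes "r\<^sub>0 > 0" "\<And>r. 0 < r \<Longrightarrow> r \<le> r\<^sub>0 \<Longrightarrow> r \<le> C * r powr \<beta>"
  shows "\<beta> \<le> 1"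
proof (rule ccontr)
  assume "\<not> \<beta> \<le> 1"
  then have \<beta>: "\<beta> - 1 > 0"
    by simp
  have "((\<lambda>r. C * r powr (\<beta> - 1)) \<longlongrightarrow> C * 0) (at_right 0)"
  proof (intro tendsto_mult tendsto_const)
    show "((\<lambda>r. r powr (\<beta> - 1)) \<longlongrightarrow> 0) (at_right (0::real))"
      using \<beta> by (intro tendsto_zero_powrI[where b = "\<beta> - 1"])
        (auto intro!: tendsto_intros eventually_at_rightI[of 0 1])
  qed
  then have "\<forall>\<^sub>F r in at_right 0. C * r powr (\<beta> - 1) < 1"
    by (rule order_tendstoD) simp
  moreover have "\<forall>\<^sub>F r in at_right 0. r \<in> {0<..<r\<^sub>0}"
    using assms(1) by (rule eventually_at_right_real)
  ultimately have "\<forall>\<^sub>F r in at_right (0::real). False"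
  proof eventually_elim
    case (elim r)
    have "r \<le> C * r powr \<beta>"
      using elim by (intro assms(2)) auto
    also have "\<dots> = C * r powr (\<beta> - 1) * r"
      using elim by (simp add: powr_diff)
    also have "\<dots> < 1 * r"
      using elim by (intro mult_strict_right_mono) auto
    finally show False
      by simp
  qed
  then show False
    by simp
qed

text \<open>
  For the flat functional at $0$, the interval $[-r, r]$ lies in the sublevel set with
  $\varepsilon = 2 K r^N$; the factor $2$ makes the inequality strict. Hence $r$ is bounded by a multiple
  of $r^{N \alpha}$ for all small $r$.
\<close>

theorem measure_nondegenerate_exponent_le:
  fixes a :: "real ^ 1 \<Rightarrow> real ^ 'n"
  assumes "A > 0" "Ck_on CARD('n) (cube A) a" "measure_nondegenerate A a \<alpha>"
  shows "\<alpha> \<le> 1 / real CARD('n)"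
proof -
  let ?N = "CARD('n)"
  obtain u \<sigma> K where flat: "(u, \<sigma>) \<in> sphere (0 :: real \<times> (real ^ 'n)) 1" "K > 0"
    "\<And>v. \<bar>v $ 1\<bar> \<le> A / 2 \<Longrightarrow> \<bar>a v \<bullet> \<sigma> - u\<bar> \<le> K * \<bar>v $ 1\<bar> ^ ?N"
    using flat_functional_at_0[OF assms(1,2)] by blast
  obtain C where C: "C > 0" "\<And>\<epsilon>. \<epsilon> > 0 \<Longrightarrow>
      measure lebesgue {v \<in> cube A. u - \<epsilon> < a v \<bullet> \<sigma> \<and> a v \<bullet> \<sigma> < u + \<epsilon>} \<le> C * \<epsilon> powr \<alpha>"
    using assms(3) flat(1) unfolding measure_nondegenerate_def by blast
  have cont: "continuous_on (cube A) (\<lambda>v. a v \<bullet> \<sigma>)"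
  proof -
    have "continuous_on (cube A) a"
    proof -
      obtain k where "?N = Suc k"
        using zero_less_card_finite[where 'a='n] by (metis gr0_implies_Suc)
      then show ?thesis
        using assms(2) by (auto intro: has_derivative_continuous_on)
    qed
    then show ?thesis
      by (intro continuous_intros)
  qed
  have "r \<le> C * (2 * K) powr \<alpha> / 2 * r powr (real ?N * \<alpha>)" if r: "0 < r" "r \<le> A / 2" for r
  proof -
    let ?\<epsilon> = "2 * K * r ^ ?N"
    have \<epsilon>: "?\<epsilon> > 0"
      using flat(2) r by simp
    have "2 * r = measure lebesgue {v :: real ^ 1. - r \<le> v $ 1 \<and> v $ 1 \<le> r}"
      using r by (subst measure_interval_1) auto
    also have "\<dots> \<le> measure lebesgue {v \<in> cube A. u - ?\<epsilon> < a v \<bullet> \<sigma> \<and> a v \<bullet> \<sigma> < u + ?\<epsilon>}"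
    proof (rule measure_mono_fmeasurable[OF _ fmeasurableD[OF measure_interval_1(2)] lmeasurable_strip[OF cont]])
      show "- r \<le> r"
        using r by simp
      show "{v :: real ^ 1. - r \<le> v $ 1 \<and> v $ 1 \<le> r}
          \<subseteq> {v \<in> cube A. u - ?\<epsilon> < a v \<bullet> \<sigma> \<and> a v \<bullet> \<sigma> < u + ?\<epsilon>}"
      proof clarify
        fix v :: "real ^ 1" assume v: "- r \<le> v $ 1" "v $ 1 \<le> r"
        then have "\<bar>v $ 1\<bar> \<le> r"
          by simp
        then have "\<bar>a v \<bullet> \<sigma> - u\<bar> \<le> K * \<bar>v $ 1\<bar> ^ ?N" "K * \<bar>v $ 1\<bar> ^ ?N \<le> K * r ^ ?N"
          using r flat(2) by (auto intro!: flat(3) mult_left_mono power_mono)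
        moreover have "K * r ^ ?N < ?\<epsilon>"
          using \<epsilon> by simp
        ultimately have "\<bar>a v \<bullet> \<sigma> - u\<bar> < ?\<epsilon>"
          by linarith
        moreover have "v \<in> cube A"
          using \<open>\<bar>v $ 1\<bar> \<le> r\<close> r by (auto simp: mem_cube)
        ultimately show "v \<in> cube A \<and> u - ?\<epsilon> < a v \<bullet> \<sigma> \<and> a v \<bullet> \<sigma> < u + ?\<epsilon>"
          by auto
      qed
    qed
    also have "\<dots> \<le> C * ?\<epsilon> powr \<alpha>"
      by (rule C(2)[OF \<epsilon>])
    also have "?\<epsilon> powr \<alpha> = (2 * K) powr \<alpha> * r powr (real ?N * \<alpha>)"
      using r flat(2) by (simp add: powr_mult powr_powr flip: powr_realpow)
    finally show ?thesis
      by simp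
  qed
  then have "real ?N * \<alpha> \<le> 1"
    using assms(1) by (intro powr_exponent_le_1[of "A / 2" "C * (2 * K) powr \<alpha> / 2"]) auto
  then show ?thesis
    by (simp add: field_simps)
qed

theorem alpha_opt_line:
  assumes "A > 0"
  shows "alpha_opt A TYPE('n::finite) TYPE(1) = 1 / real CARD('n)"
  unfolding alpha_opt_def
proof (rule cSup_eq_maximum)
  obtain e :: "'n \<Rightarrow> nat" where e: "bij_betw e UNIV {1..CARD('n)}"
    using exists_exponents by blast
  have "smooth_on (cube A) (moment_curve e)"
    by (simp add: moment_curve_def smooth_on_poly_curve)
  with measure_nondegenerate_moment_curve[OF assms e]
  show "1 / real CARD('n) \<in> {\<alpha>. 0 < \<alpha> \<and> \<alpha> \<le> 1 \<and>
       (\<exists>a :: real ^ 1 \<Rightarrow> real ^ 'n. smooth_on (cube A) a \<and> measure_nondegenerate A a \<alpha>)}"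
    by (auto simp: divide_le_eq_1 Suc_le_eq)
qed (use measure_nondegenerate_exponent_le[OF assms] in \<open>auto simp: smooth_on_def\<close>)


section \<open>The identity field\<close>

lemma Ck_on_const: "Ck_on k S (\<lambda>v. c)"
  by (induction k arbitrary: c) (auto intro!: exI[of _ "\<lambda>_ _. 0"] derivative_eq_intros)

lemma smooth_on_id: "smooth_on S (\<lambda>v. v)"
proof -
  have "Ck_on k S (\<lambda>v. v)" for k
    using Ck_on_const by (cases k) (auto intro!: exI[of _ "\<lambda>_ h. h"])
  then show ?thesis
    by (simp add: smooth_on_def)
qed

text \<open>
  The slab of half-width $\varepsilon$ and its translates by multiples of
  $\tau = (2 \varepsilon / |\sigma|^2)\, \sigma$ are pairwise disjoint, because $\tau \cdot \sigma = 2 \varepsilon$.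
  At least $R |\sigma| / (2 \varepsilon)$ translates of $S$ fit into the ball of radius $2 R$, and they all
  have the same measure.
\<close>

lemma measure_slab_le:
  fixes S :: "'a::euclidean_space set"
  assumes S: "S \<in> lmeasurable" "\<And>v. v \<in> S \<Longrightarrow> norm v \<le> R" "\<And>v. v \<in> S \<Longrightarrow> \<bar>v \<bullet> \<sigma> - u\<bar> < \<epsilon>"
    and "\<sigma> \<noteq> 0" "\<epsilon> > 0" "R > 0"
  shows "measure lebesgue S \<le> 2 * \<epsilon> / norm \<sigma> * (measure lebesgue (cball (0 :: 'a) (2 * R)) / R)"
proof -
  let ?s = "norm \<sigma>"
  let ?U = "measure lebesgue (cball (0 :: 'a) (2 * R))"
  have s: "?s > 0"
    using assms(4) by simp
  define \<tau> where "\<tau> = (2 * \<epsilon> / ?s\<^sup>2) *\<^sub>R \<sigma>"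
  have norm_\<tau>: "norm \<tau> = 2 * \<epsilon> / ?s"
    using s assms(5) by (simp add: \<tau>_def power2_eq_square)
  have "\<tau> \<bullet> \<sigma> = 2 * \<epsilon> / ?s\<^sup>2 * ?s\<^sup>2"
    by (simp only: \<tau>_def inner_scaleR_left power2_norm_eq_inner)
  then have \<tau>\<sigma>: "\<tau> \<bullet> \<sigma> = 2 * \<epsilon>"
    using s by simp
  define K where "K = nat \<lfloor>R * ?s / (2 * \<epsilon>)\<rfloor>"
  have "R * ?s / (2 * \<epsilon>) \<ge> 0"
    using s assms(5,6) by simp
  then have K_le: "real K \<le> R * ?s / (2 * \<epsilon>)" and K_ge: "R * ?s / (2 * \<epsilon>) \<le> real (K + 1)"
    unfolding K_def by linarith+
  let ?T = "\<lambda>k. (+) (real k *\<^sub>R \<tau>) ` S"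
  have T: "?T k \<in> lmeasurable" "measure lebesgue (?T k) = measure lebesgue S" for k
    using S(1) by (simp_all add: measurable_translation measure_translation)
  have level: "\<bar>w \<bullet> \<sigma> - u - 2 * \<epsilon> * real k\<bar> < \<epsilon>" if w: "w \<in> ?T k" for w k
  proof -
    obtain v where v: "v \<in> S" "w = real k *\<^sub>R \<tau> + v"
      using w by blast
    have "w \<bullet> \<sigma> - u - 2 * \<epsilon> * real k = v \<bullet> \<sigma> - u"
      by (simp add: v(2) inner_add_left \<tau>\<sigma>)
    then show ?thesis
      using S(3)[OF v(1)] by simp
  qed
  have disj: "pairwise (\<lambda>j k. disjnt (?T j) (?T k)) {..K}"
  proof (rule pairwiseI)
    fix j k :: nat assume "j \<noteq> k"
    have "w \<notin> ?T k" if "w \<in> ?T j" for w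
    proof
      assume "w \<in> ?T k"
      from level[OF that] level[OF this]
      have "\<bar>2 * \<epsilon> * real j - 2 * \<epsilon> * real k\<bar> < 2 * \<epsilon>"
        by linarith
      moreover have "\<bar>2 * \<epsilon> * real j - 2 * \<epsilon> * real k\<bar> = 2 * \<epsilon> * \<bar>real j - real k\<bar>"
        using assms(5) by (simp add: abs_mult flip: right_diff_distrib)
      moreover have "2 * \<epsilon> * 1 \<le> 2 * \<epsilon> * \<bar>real j - real k\<bar>"
        using assms(5) \<open>j \<noteq> k\<close> by (intro mult_left_mono) linarith+
      ultimately show False
        by linarith
    qed
    then show "disjnt (?T j) (?T k)"
      unfolding disjnt_iff by blast
  qed
  have sub: "(\<Union>k\<le>K. ?T k) \<subseteq> cball 0 (2 * R)"
  proof
    fix w assume "w \<in> (\<Union>k\<le>K. ?T k)"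
    then obtain k v where k: "k \<le> K" and v: "v \<in> S" and w: "w = real k *\<^sub>R \<tau> + v"
      by blast
    have "norm (real k *\<^sub>R \<tau>) = real k * (2 * \<epsilon> / ?s)"
      by (simp add: norm_\<tau>)
    also have "\<dots> \<le> R * ?s / (2 * \<epsilon>) * (2 * \<epsilon> / ?s)"
      using k K_le s assms(5) by (intro mult_right_mono) auto
    also have "\<dots> = R"
      using s assms(5) by simp
    finally have "norm (real k *\<^sub>R \<tau>) \<le> R" .
    then have "norm w \<le> R + R"
      unfolding w using S(2)[OF v] by (intro norm_triangle_le add_mono)
    then show "w \<in> cball 0 (2 * R)"
      by simp
  qed
  have "real (K + 1) * measure lebesgue S = (\<Sum>k\<le>K. measure lebesgue (?T k))"
    by (simp add: T(2))
  also have "\<dots> = measure lebesgue (\<Union>k\<le>K. ?T k)"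
    by (rule measure_UNION'[symmetric]) (use T(1) disj in auto)
  also have "\<dots> \<le> ?U"
    using T(1) by (intro measure_mono_fmeasurable[OF sub] fmeasurableD fmeasurable.finite_UN) auto
  finally have "real (K + 1) * measure lebesgue S \<le> ?U" .
  moreover have "R * ?s / (2 * \<epsilon>) * measure lebesgue S \<le> real (K + 1) * measure lebesgue S"
    using K_ge by (rule mult_right_mono) simp
  ultimately have "R * ?s / (2 * \<epsilon>) * measure lebesgue S \<le> ?U"
    by linarith
  then show ?thesis
    using s assms(5,6) by (simp add: field_simps)
qed

text \<open>
  With $|v| \le R$ on the cube, $|v \cdot \sigma - u| \ge 1 - (1 + R)|\sigma|$. So the sublevel set is
  empty when $\varepsilon \le 1/2$ and $(1 + R)|\sigma| \le 1/2$; for larger $|\sigma|$ the slab estimate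
  applies, and for larger $\varepsilon$ the measure of the whole cube is a sufficient bound.
\<close>

theorem measure_nondegenerate_id:
  assumes "A > 0"
  shows "measure_nondegenerate A (\<lambda>v :: real ^ 'n. v) 1"
proof -
  define R where "R = real CARD('n) * A"
  have R: "R > 0"
    using assms by (simp add: R_def)
  define V where "V = measure lebesgue (cube A :: (real ^ 'n) set)"
  define Q where "Q = measure lebesgue (cball (0 :: real ^ 'n) (2 * R)) / R"
  define W where "W = 4 * (1 + R) * Q"
  have V: "V \<ge> 0"
    by (simp add: V_def)
  have Q: "Q \<ge> 0"
    using R by (simp add: Q_def)
  have W: "W \<ge> 0"
    using R Q by (simp add: W_def)
  have bound: "measure lebesgue {v \<in> cube A. u - \<epsilon> < v \<bullet> \<sigma> \<and> v \<bullet> \<sigma> < u + \<epsilon>}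
      \<le> (2 * V + W + 1) * \<epsilon> powr 1"
    if sph: "(u, \<sigma>) \<in> sphere (0 :: real \<times> (real ^ 'n)) 1" and \<epsilon>: "\<epsilon> > 0" for u \<sigma> \<epsilon>
  proof -
    let ?E = "{v \<in> cube A. u - \<epsilon> < v \<bullet> \<sigma> \<and> v \<bullet> \<sigma> < u + \<epsilon>}"
    have E: "?E \<in> lmeasurable"
      by (intro lmeasurable_strip continuous_intros)
    have ER: "norm v \<le> R" if "v \<in> ?E" for v
      using that norm_le_on_cube[of v A] by (simp add: R_def)
    consider "\<epsilon> > 1 / 2" | "\<epsilon> \<le> 1 / 2" "(1 + R) * norm \<sigma> \<le> 1 / 2" | "(1 + R) * norm \<sigma> > 1 / 2"
      by linarith
    then have "measure lebesgue ?E \<le> 2 * V * \<epsilon> \<or> measure lebesgue ?E \<le> W * \<epsilon>"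
    proof cases
      case 1
      have "measure lebesgue ?E \<le> V"
        unfolding V_def by (intro measure_mono_fmeasurable fmeasurableD[OF E]) (auto simp: cube_def)
      also have "V * 1 \<le> V * (2 * \<epsilon>)"
        using 1 V by (intro mult_left_mono) auto
      finally show ?thesis
        by simp
    next
      case 2
      have "?E = {}"
      proof (rule ccontr)
        assume "?E \<noteq> {}"
        then obtain v where v: "v \<in> ?E"
          by blast
        have "1 = norm (u, \<sigma>)"
          using sph by simp
        also have "\<dots> \<le> \<bar>u\<bar> + norm \<sigma>"
          by (metis norm_Pair_le real_norm_def)
        also have "\<bar>u\<bar> < \<epsilon> + \<bar>v \<bullet> \<sigma>\<bar>"
          using v by auto
        also have "\<bar>v \<bullet> \<sigma>\<bar> \<le> norm v * norm \<sigma>"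
          by (rule Cauchy_Schwarz_ineq2)
        also have "\<dots> \<le> R * norm \<sigma>"
          using ER[OF v] by (intro mult_right_mono) auto
        finally show False
          using 2 by (simp add: algebra_simps)
      qed
      then have "measure lebesgue ?E = 0"
        by (simp only: measure_empty)
      then show ?thesis
        using W \<epsilon> by simp
    next
      case 3
      then have \<sigma>: "\<sigma> \<noteq> 0"
        by auto
      have "measure lebesgue ?E \<le> 2 * \<epsilon> / norm \<sigma> * Q"
        unfolding Q_def using \<sigma> \<epsilon> R ER by (intro measure_slab_le[OF E, where u = u]) auto
      also have "\<dots> \<le> 4 * (1 + R) * \<epsilon> * Q"
      proof (rule mult_right_mono)
        show "2 * \<epsilon> / norm \<sigma> \<le> 4 * (1 + R) * \<epsilon>"
          using \<sigma> mult_strict_left_mono[OF 3 \<epsilon>] by (simp add: pos_divide_le_eq algebra_simps)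
      qed (rule Q)
      also have "\<dots> = W * \<epsilon>"
        by (simp add: W_def)
      finally show ?thesis
        by simp
    qed
    moreover have "2 * V * \<epsilon> \<ge> 0" "W * \<epsilon> \<ge> 0"
      using V W \<epsilon> by auto
    moreover have "(2 * V + W + 1) * \<epsilon> = 2 * V * \<epsilon> + W * \<epsilon> + \<epsilon>"
      by (simp add: distrib_right)
    ultimately have "measure lebesgue ?E \<le> (2 * V + W + 1) * \<epsilon>"
      using \<epsilon> by linarith
    then show ?thesis
      using \<epsilon> by simp
  qed
  show ?thesis
    unfolding measure_nondegenerate_def
  proof (intro exI conjI)
    show "2 * V + W + 1 > 0"
      using V W by linarith
    show "\<forall>(u, \<sigma>) \<in> sphere (0 :: real \<times> (real ^ 'n)) 1. \<forall>\<epsilon>>0.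
        measure lebesgue {v \<in> cube A. u - \<epsilon> < v \<bullet> \<sigma> \<and> v \<bullet> \<sigma> < u + \<epsilon>}
          \<le> (2 * V + W + 1) * \<epsilon> powr 1"
      using bound by fast
  qed
qed

theorem alpha_opt_square:
  assumes "A > 0"
  shows "alpha_opt A TYPE('n::finite) TYPE('n) = 1"
  unfolding alpha_opt_def
proof (rule cSup_eq_maximum)
  show "1 \<in> {\<alpha>. 0 < \<alpha> \<and> \<alpha> \<le> 1 \<and>
       (\<exists>a :: real ^ 'n \<Rightarrow> real ^ 'n. smooth_on (cube A) a \<and> measure_nondegenerate A a \<alpha>)}"
    using measure_nondegenerate_id[OF assms] smooth_on_id by auto
qed auto

theorem theorem3:
  fixes A :: real
  assumes "A > 0"
  shows "(CARD('n::finite) \<ge> 2 \<longrightarrow>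
            1 / real (gamma_opt TYPE('n) TYPE(1)) = 1 / (real CARD('n) + 1) \<and>
            1 / (real CARD('n) + 1) > alpha_opt A TYPE('n) TYPE(1) / 2 \<and>
            alpha_opt A TYPE('n) TYPE(1) / 2 = 1 / (2 * real CARD('n)))
       \<and> alpha_opt A TYPE('n) TYPE('n) = 1
       \<and> (\<exists>a :: real ^ 'n \<Rightarrow> real ^ 'n. smooth_on UNIV a \<and> measure_nondegenerate A a 1)"
proof (intro conjI impI)
  show "1 / real (gamma_opt TYPE('n) TYPE(1)) = 1 / (real CARD('n) + 1)"
    by (simp add: gamma_opt_line)
  show "alpha_opt A TYPE('n) TYPE(1) / 2 = 1 / (2 * real CARD('n))"
    by (simp add: alpha_opt_line[OF assms])
  show "1 / (real CARD('n) + 1) > alpha_opt A TYPE('n) TYPE(1) / 2" if "CARD('n) \<ge> 2"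
    using that by (simp add: alpha_opt_line[OF assms] field_simps)
  show "alpha_opt A TYPE('n) TYPE('n) = 1"
    by (rule alpha_opt_square[OF assms])
  show "\<exists>a :: real ^ 'n \<Rightarrow> real ^ 'n. smooth_on UNIV a \<and> measure_nondegenerate A a 1"
    using measure_nondegenerate_id[OF assms] smooth_on_id by blast
qed

end
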